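(* Let $\mathcal{B}$ be a small category, let $\mathcal{C}$ and $\mathcal{D}$ be locally small categories, let $F:\mathcal{B}\to\mathcal{C}$ and $G:\mathcal{B}\to\mathcal{D}$ be functors, and let $c\in\mathcal{C}$ and $d\in\mathcal{D}$ be objects. Let $P_{c,d}:F/c\to\mathsf{Set}$ be the composite $$F/c\xrightarrow{\;V_{F,c}\;}\mathcal{B}\xrightarrow{\;G\;}\mathcal{D}\xrightarrow{\;\mathcal{D}(d,-)\;}\mathsf{Set}.$$ If $G$ satisfies the Weak Pullback Condition (WPC), then the relation $\Lambda_{c,d}=\Lambda_{1/P_{c,d}}$ on the objects of the category of elements $1/P_{c,d}$ is an equivalence relation. Hence, $$\mathrm{colim}\,P_{c,d}\;\cong\;\left(\coprod_{b\in\mathcal{B}}\mathcal{D}(d,Gb)\times\mathcal{C}(Fb,c)\right)\Big/\Lambda_{c,d}\,.$$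
   Context: The comma category $F/c$ has as objects pairs $(b,z)$ with $b\in\mathcal{B}$ and $z:Fb\to c$ in $\mathcal{C}$; a morphism $f:(b,z)\to(b',z')$ is a map $f:b\to b'$ in $\mathcal{B}$ with $z'\cdot Ff=z$. The functor $V_{F,c}:F/c\to\mathcal{B}$ is the forgetful functor $(b,z)\mapsto b$. The category of elements $1/H$ of a functor $H:\mathcal{K}\to\mathsf{Set}$ has as objects pairs $(k,x)$ with $k\in\mathcal{K}$ and $x\in Hk$; a morphism $f:(k,x)\to(k',x')$ is a map $f:k\to k'$ in $\mathcal{K}$ with $(Hf)x=x'$. The objects of $1/P_{c,d}$ are thus identified with triples $(b,u,v)$ with $b\in\mathcal{B}$, $u:Fb\to c$ in $\mathcal{C}$ and $v:d\to Gb$ in $\mathcal{D}$, i.e. with the elements of $\coprod_{b\in\mathcal{B}}\mathcal{D}(d,Gb)\times\mathcal{C}(Fb,c)$. For any category $\mathcal{K}$, the relation $\Lambda_{\mathcal{K}}$ on the objects of $\mathcal{K}$ is defined by: $x\,\Lambda_{\mathcal{K}}\,y$ if and only if there is a span $x\leftarrow w\to y$ of maps in $\mathcal{K}$. A functor $G:\mathcal{B}\to\mathcal{D}$ satisfies the Weak Pullback Condition (WPC) if every cospan $x\xrightarrow{f} z\xleftarrow{g} y$ in $\mathcal{B}$ can be completed to a commutative square $f\cdot p=g\cdot q$ (with $p:w\to x$, $q:w\to y$ in $\mathcal{B}$) that $G$ transforms into a weak pullback diagram in $\mathcal{D}$, where a weak pullback has the existence but not necessarily the uniqueness part of the universal property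 of a pullback. *)

theory Defs
  imports Main "HOL-Library.FuncSet"
begin

section \<open>Categories and functors\<close>

text \<open>
  Objects and arrows form sets over arbitrary types, so every hom-class is a set. The values of
  \<open>Ident\<close>, \<open>Dom\<close>, \<open>Cod\<close> and \<open>Comp\<close> outside of \<open>Obj\<close>, \<open>Arr\<close> and the composable pairs are
  irrelevant.
\<close>

record ('o, 'a) precategory =
  Obj :: "'o set"
  Arr :: "'a set"
  Dom :: "'a \<Rightarrow> 'o"
  Cod :: "'a \<Rightarrow> 'o"
  Ident :: "'o \<Rightarrow> 'a"
  Comp :: "'a \<Rightarrow> 'a \<Rightarrow> 'a"  (infixl "\<cdot>\<index>" 70)

definition Hom :: "('o, 'a) precategory \<Rightarrow> 'o \<Rightarrow> 'o \<Rightarrow> 'a set" where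
  "Hom K x y = {f \<in> Arr K. Dom K f = x \<and> Cod K f = y}"

locale category =
  fixes K :: "('o, 'a) precategory" (structure)
  assumes Dom_Obj: "f \<in> Arr K \<Longrightarrow> Dom K f \<in> Obj K"
    and Cod_Obj: "f \<in> Arr K \<Longrightarrow> Cod K f \<in> Obj K"
    and Ident_Hom: "x \<in> Obj K \<Longrightarrow> Ident K x \<in> Hom K x x"
    and Comp_Hom: "f \<in> Hom K x y \<Longrightarrow> g \<in> Hom K y z \<Longrightarrow> g \<cdot> f \<in> Hom K x z"
    and Ident_left: "f \<in> Hom K x y \<Longrightarrow> Ident K y \<cdot> f = f"
    and Ident_right: "f \<in> Hom K x y \<Longrightarrow> f \<cdot> Ident K x = f"
    and Comp_assoc: "f \<in> Hom K w x \<Longrightarrow> g \<in> Hom K x y \<Longrightarrow> h \<in> Hom K y z \<Longrightarrow>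
      (h \<cdot> g) \<cdot> f = h \<cdot> (g \<cdot> f)"

record ('o1, 'a1, 'o2, 'a2) prefunctor =
  fobj :: "'o1 \<Rightarrow> 'o2"
  farr :: "'a1 \<Rightarrow> 'a2"

locale functor_between =
  dom: category K + cod: category L
  for K :: "('o1, 'a1) precategory" and L :: "('o2, 'a2) precategory"
    and F :: "('o1, 'a1, 'o2, 'a2) prefunctor" +
  assumes fobj_Obj: "x \<in> Obj K \<Longrightarrow> fobj F x \<in> Obj L"
    and farr_Hom: "f \<in> Hom K x y \<Longrightarrow> farr F f \<in> Hom L (fobj F x) (fobj F y)"
    and farr_Ident: "x \<in> Obj K \<Longrightarrow> farr F (Ident K x) = Ident L (fobj F x)"
    and farr_Comp: "f \<in> Hom K x y \<Longrightarrow> g \<in> Hom K y z \<Longrightarrow>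
      farr F (g \<cdot>\<^bsub>K\<^esub> f) = farr F g \<cdot>\<^bsub>L\<^esub> farr F f"

definition functor_comp ::
  "('o2, 'a2, 'o3, 'a3) prefunctor \<Rightarrow> ('o1, 'a1, 'o2, 'a2) prefunctor \<Rightarrow>
   ('o1, 'a1, 'o3, 'a3) prefunctor"  (infixl "\<odot>" 70) where
  "H \<odot> F = \<lparr>fobj = fobj H \<circ> fobj F, farr = farr H \<circ> farr F\<rparr>"

section \<open>Sets, hom-functors, comma categories and categories of elements\<close>

text \<open>
  The category of sets with elements in \<open>'x\<close>. An arrow is a triple \<open>(X, f, Y)\<close>, where \<open>f\<close> is
  normalised to be undefined outside of \<open>X\<close>, so that equality of arrows is equality of maps.
\<close>

type_synonym 'x set_arrow = "'x set \<times> ('x \<Rightarrow> 'x) \<times> 'x set"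

definition set_cat :: "('x set, 'x set_arrow) precategory" where
  "set_cat = \<lparr>
     Obj = UNIV,
     Arr = {(X, f, Y). f \<in> X \<rightarrow>\<^sub>E Y},
     Dom = (\<lambda>(X, f, Y). X),
     Cod = (\<lambda>(X, f, Y). Y),
     Ident = (\<lambda>X. (X, (\<lambda>x\<in>X. x), X)),
     Comp = (\<lambda>(Y, g, Z) (X, f, Y'). (X, compose X g f, Z))\<rparr>"

definition map_of_arrow :: "'x set_arrow \<Rightarrow> 'x \<Rightarrow> 'x" where
  "map_of_arrow = (\<lambda>(X, f, Y). f)"

type_synonym ('o, 'a, 'x) set_functor = "('o, 'a, 'x set, 'x set_arrow) prefunctor"

definition hom_functor :: "('o, 'a) precategory \<Rightarrow> 'o \<Rightarrow> ('o, 'a, 'a) set_functor" where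
  "hom_functor D d = \<lparr>
     fobj = (\<lambda>y. Hom D d y),
     farr = (\<lambda>g. (Hom D d (Dom D g), (\<lambda>v \<in> Hom D d (Dom D g). g \<cdot>\<^bsub>D\<^esub> v), Hom D d (Cod D g)))\<rparr>"

text \<open>
  An arrow \<open>f : x \<rightarrow> y\<close> of a comma category or of a category of elements is the triple
  \<open>(x, f, y)\<close>: the underlying arrow alone does not determine source and target.
\<close>

definition comma_cat ::
  "('bo, 'ba) precategory \<Rightarrow> ('co, 'ca) precategory \<Rightarrow> ('bo, 'ba, 'co, 'ca) prefunctor \<Rightarrow> 'co \<Rightarrow>
   ('bo \<times> 'ca, ('bo \<times> 'ca) \<times> 'ba \<times> ('bo \<times> 'ca)) precategory" where
  "comma_cat B C F c =
    (let Ob = {(b, z). b \<in> Obj B \<and> z \<in> Hom C (fobj F b) c} in \<lparr>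
     Obj = Ob,
     Arr = {((b, z), f, (b', z')). (b, z) \<in> Ob \<and> (b', z') \<in> Ob \<and> f \<in> Hom B b b' \<and>
              z' \<cdot>\<^bsub>C\<^esub> farr F f = z},
     Dom = (\<lambda>(x, f, y). x),
     Cod = (\<lambda>(x, f, y). y),
     Ident = (\<lambda>(b, z). ((b, z), Ident B b, (b, z))),
     Comp = (\<lambda>(y, g, z) (x, f, y'). (x, g \<cdot>\<^bsub>B\<^esub> f, z))\<rparr>)"

definition comma_forget ::
  "('bo \<times> 'ca, ('bo \<times> 'ca) \<times> 'ba \<times> ('bo \<times> 'ca), 'bo, 'ba) prefunctor" where
  "comma_forget = \<lparr>fobj = (\<lambda>(b, z). b), farr = (\<lambda>(x, f, y). f)\<rparr>"

definition elements ::
  "('o, 'a) precategory \<Rightarrow> ('o, 'a, 'x) set_functor \<Rightarrow>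
   ('o \<times> 'x, ('o \<times> 'x) \<times> 'a \<times> ('o \<times> 'x)) precategory" where
  "elements K H =
    (let Ob = {(k, x). k \<in> Obj K \<and> x \<in> fobj H k} in \<lparr>
     Obj = Ob,
     Arr = {((k, x), f, (k', x')). (k, x) \<in> Ob \<and> (k', x') \<in> Ob \<and> f \<in> Hom K k k' \<and>
              map_of_arrow (farr H f) x = x'},
     Dom = (\<lambda>(x, f, y). x),
     Cod = (\<lambda>(x, f, y). y),
     Ident = (\<lambda>(k, x). ((k, x), Ident K k, (k, x))),
     Comp = (\<lambda>(y, g, z) (x, f, y'). (x, g \<cdot>\<^bsub>K\<^esub> f, z))\<rparr>)"

lemma category_set_cat: "category (set_cat :: ('x set, 'x set_arrow) precategory)"
  by unfold_locales
   (fastforce simp: set_cat_def Hom_def compose_def PiE_def Pi_def extensional_def fun_eq_iff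
      split: prod.splits)+

lemma category_comma_cat:
  assumes "functor_between B C F"
  shows "category (comma_cat B C F c)"
proof -
  interpret functor_between B C F by fact
  show ?thesis
    apply unfold_locales
    subgoal by (auto simp: comma_cat_def Hom_def Let_def)
    subgoal by (auto simp: comma_cat_def Hom_def Let_def)
    subgoal for x using dom.Ident_Hom[of "fst x"] farr_Ident[of "fst x"]
      cod.Ident_right[of "snd x" "fobj F (fst x)" c]
      by (auto simp: comma_cat_def Hom_def Let_def split: prod.splits)
    subgoal for f x y g z
      using farr_Comp dom.Comp_Hom cod.Comp_assoc farr_Hom
      by (clarsimp simp: comma_cat_def Hom_def Let_def split: prod.splits)
    subgoal using dom.Ident_left by (auto simp: comma_cat_def Hom_def Let_def split: prod.splits)
    subgoal using dom.Ident_right by (auto simp: comma_cat_def Hom_def Let_def split: prod.splits)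
    subgoal using dom.Comp_assoc by (auto simp: comma_cat_def Hom_def Let_def split: prod.splits)
    done
qed

lemma functor_comma_forget:
  assumes "functor_between B C F"
  shows "functor_between (comma_cat B C F c) B comma_forget"
proof -
  interpret functor_between B C F by fact
  interpret cc: category "comma_cat B C F c" by (rule category_comma_cat) fact
  show ?thesis
    by unfold_locales
      (auto simp: comma_cat_def Hom_def Let_def comma_forget_def split: prod.splits)
qed

lemma functor_functor_comp:
  assumes "functor_between B C F" "functor_between C D G"
  shows "functor_between B D (G \<odot> F)"
proof -
  interpret F: functor_between B C F by fact
  interpret G: functor_between C D G by fact
  show ?thesis
    apply unfold_locales
    apply (simp_all add: functor_comp_def F.fobj_Obj G.fobj_Obj F.farr_Ident G.farr_Ident)
    using F.farr_Hom G.farr_Hom apply blast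
    by (metis F.farr_Comp F.farr_Hom G.farr_Comp)
qed

lemma functor_hom_functor:
  assumes "category D" "d \<in> Obj D"
  shows "functor_between D set_cat (hom_functor D d)"
proof -
  interpret category D by fact
  interpret s: category set_cat by (rule category_set_cat)
  show ?thesis
    apply unfold_locales
    subgoal by (simp add: set_cat_def)
    subgoal for f x y using Comp_Hom[of _ d x f y]
      by (auto simp: Hom_def set_cat_def hom_functor_def)
    subgoal for x using Ident_Hom[of x] Ident_left[of _ d x]
      by (auto simp: Hom_def set_cat_def hom_functor_def fun_eq_iff)
    subgoal for f x y g z
      using Comp_Hom[of f x y g z] Comp_Hom[of _ d x f y] Comp_assoc[of _ d x f y g z]
      by (auto simp: Hom_def set_cat_def hom_functor_def fun_eq_iff compose_def)
    done
qed

lemma category_elements: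
  assumes "functor_between K set_cat H"
  shows "category (elements K H)"
proof -
  interpret functor_between K set_cat H by fact
  have A: "map_of_arrow (farr H f) x \<in> fobj H y'" if "f \<in> Hom K x' y'" "x \<in> fobj H x'" for f x x' y'
    using farr_Hom[OF that(1)] that(2)
    by (auto simp: set_cat_def Hom_def map_of_arrow_def split: prod.splits)
  have I: "map_of_arrow (farr H (Ident K k)) x = x" if "k \<in> Obj K" "x \<in> fobj H k" for k x
    using farr_Ident[OF that(1)] that by (simp add: set_cat_def map_of_arrow_def)
  have Cc: "map_of_arrow (farr H (g \<cdot>\<^bsub>K\<^esub> f)) x = map_of_arrow (farr H g) (map_of_arrow (farr H f) x)"
    if "f \<in> Hom K a b" "g \<in> Hom K b c" "x \<in> fobj H a" for f g a b c x
    using farr_Comp[OF that(1,2)] farr_Hom[OF that(1)] farr_Hom[OF that(2)] that(3)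
    by (auto simp: set_cat_def Hom_def map_of_arrow_def compose_def split: prod.splits)
  show ?thesis
    apply unfold_locales
    subgoal by (auto simp: elements_def Hom_def Let_def)
    subgoal by (auto simp: elements_def Hom_def Let_def)
    subgoal for x using dom.Ident_Hom[of "fst x"] I
      by (auto simp: elements_def Hom_def Let_def split: prod.splits)
    subgoal for f x y g z
      using Cc dom.Comp_Hom
      by (clarsimp simp: elements_def Hom_def Let_def split: prod.splits)
    subgoal using dom.Ident_left by (auto simp: elements_def Hom_def Let_def split: prod.splits)
    subgoal using dom.Ident_right by (auto simp: elements_def Hom_def Let_def split: prod.splits)
    subgoal using dom.Comp_assoc by (auto simp: elements_def Hom_def Let_def split: prod.splits)
    done
qed

section \<open>The span relation and the Weak Pullback Condition\<close>

definition span_rel :: "('o, 'a) precategory \<Rightarrow> ('o \<times> 'o) set" where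
  "span_rel K = {(x, y). x \<in> Obj K \<and> y \<in> Obj K \<and>
     (\<exists>w \<in> Obj K. \<exists>p \<in> Hom K w x. \<exists>q \<in> Hom K w y. True)}"

definition weak_pullback ::
  "('o, 'a) precategory \<Rightarrow> 'o \<Rightarrow> 'o \<Rightarrow> 'o \<Rightarrow> 'o \<Rightarrow> 'a \<Rightarrow> 'a \<Rightarrow> 'a \<Rightarrow> 'a \<Rightarrow> bool" where
  "weak_pullback D w x y z p q f g \<longleftrightarrow>
     p \<in> Hom D w x \<and> q \<in> Hom D w y \<and> f \<in> Hom D x z \<and> g \<in> Hom D y z \<and>
     f \<cdot>\<^bsub>D\<^esub> p = g \<cdot>\<^bsub>D\<^esub> q \<and>
     (\<forall>e \<in> Obj D. \<forall>s \<in> Hom D e x. \<forall>t \<in> Hom D e y. f \<cdot>\<^bsub>D\<^esub> s = g \<cdot>\<^bsub>D\<^esub> t \<longrightarrow>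
        (\<exists>h \<in> Hom D e w. p \<cdot>\<^bsub>D\<^esub> h = s \<and> q \<cdot>\<^bsub>D\<^esub> h = t))"

definition WPC ::
  "('bo, 'ba) precategory \<Rightarrow> ('do, 'da) precategory \<Rightarrow> ('bo, 'ba, 'do, 'da) prefunctor \<Rightarrow> bool" where
  "WPC B D G \<longleftrightarrow>
     (\<forall>x \<in> Obj B. \<forall>y \<in> Obj B. \<forall>z \<in> Obj B. \<forall>f \<in> Hom B x z. \<forall>g \<in> Hom B y z.
        \<exists>w \<in> Obj B. \<exists>p \<in> Hom B w x. \<exists>q \<in> Hom B w y. f \<cdot>\<^bsub>B\<^esub> p = g \<cdot>\<^bsub>B\<^esub> q \<and>
          weak_pullback D (fobj G w) (fobj G x) (fobj G y) (fobj G z)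
            (farr G p) (farr G q) (farr G f) (farr G g))"

section \<open>Colimits of set-valued functors\<close>

text \<open>
  The vertex of a cocone may be a set over a different type than the values of the functor;
  this is needed because a quotient of a disjoint union of the values lives over another type.
\<close>

definition is_cocone ::
  "('o, 'a) precategory \<Rightarrow> ('o, 'a, 'x) set_functor \<Rightarrow> 'l set \<Rightarrow> ('o \<Rightarrow> 'x \<Rightarrow> 'l) \<Rightarrow> bool" where
  "is_cocone K H L l \<longleftrightarrow>
     (\<forall>k \<in> Obj K. \<forall>x \<in> fobj H k. l k x \<in> L) \<and>
     (\<forall>k \<in> Obj K. \<forall>k' \<in> Obj K. \<forall>f \<in> Hom K k k'. \<forall>x \<in> fobj H k.
        l k' (map_of_arrow (farr H f) x) = l k x)"

text \<open>
  Universality is tested against all cocones whose vertex is a set over the type \<open>'y\<close> named by the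
  first argument, since types cannot be quantified inside a definition. Universality against
  all sets is expressed by leaving \<open>'y\<close> a free type variable of a theorem's conclusion.
  Assuming universality for a single type \<open>'y\<close> is weaker than being a colimit, so a hypothesis of
  the form \<open>is_colimit TYPE('y) \<dots>\<close> covers all actual colimits.
\<close>

definition is_colimit ::
  "'y itself \<Rightarrow> ('o, 'a) precategory \<Rightarrow> ('o, 'a, 'x) set_functor \<Rightarrow>
   'l set \<Rightarrow> ('o \<Rightarrow> 'x \<Rightarrow> 'l) \<Rightarrow> bool" where
  "is_colimit T K H L l \<longleftrightarrow> is_cocone K H L l \<and>
     (\<forall>(M :: 'y set) m. is_cocone K H M m \<longrightarrow>
        (\<exists>!h. h \<in> L \<rightarrow>\<^sub>E M \<and> (\<forall>k \<in> Obj K. \<forall>x \<in> fobj H k. h (l k x) = m k x)))"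

section \<open>The functor $P_{c,d}$\<close>

definition P_functor ::
  "('do, 'da) precategory \<Rightarrow> ('bo, 'ba, 'do, 'da) prefunctor \<Rightarrow> 'do \<Rightarrow>
   ('bo \<times> 'ca, ('bo \<times> 'ca) \<times> 'ba \<times> ('bo \<times> 'ca), 'da) set_functor" where
  "P_functor D G d = hom_functor D d \<odot> G \<odot> comma_forget"

lemma functor_P_functor:
  assumes "functor_between B C F" "functor_between B D G" "d \<in> Obj D"
  shows "functor_between (comma_cat B C F c) set_cat (P_functor D G d)"
  unfolding P_functor_def
  using functor_functor_comp[OF functor_comma_forget[OF assms(1)] functor_functor_comp[OF assms(2) functor_hom_functor]] assms
  by (simp add: functor_between_def functor_comp_def comp_assoc)

definition P_coproduct ::
  "('bo, 'ba) precategory \<Rightarrow> ('co, 'ca) precategory \<Rightarrow> ('do, 'da) precategory \<Rightarrow>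
   ('bo, 'ba, 'co, 'ca) prefunctor \<Rightarrow> ('bo, 'ba, 'do, 'da) prefunctor \<Rightarrow> 'co \<Rightarrow> 'do \<Rightarrow>
   ('bo \<times> 'da \<times> 'ca) set" where
  "P_coproduct B C D F G c d = (SIGMA b : Obj B. Hom D d (fobj G b) \<times> Hom C (fobj F b) c)"

definition as_element :: "'bo \<times> 'da \<times> 'ca \<Rightarrow> ('bo \<times> 'ca) \<times> 'da" where
  "as_element = (\<lambda>(b, v, u). ((b, u), v))"

lemma bij_betw_as_element:
  "bij_betw as_element (P_coproduct B C D F G c d)
     (Obj (elements (comma_cat B C F c) (P_functor D G d)))"
  unfolding bij_betw_def inj_on_def as_element_def P_coproduct_def elements_def comma_cat_def
    P_functor_def comma_forget_def functor_comp_def hom_functor_def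
  by (force simp: Let_def image_def)

text \<open>\<open>\<Lambda>\<^sub>c\<^sub>,\<^sub>d\<close>, transported along \<open>as_element\<close> to the coproduct.\<close>

definition P_rel ::
  "('bo, 'ba) precategory \<Rightarrow> ('co, 'ca) precategory \<Rightarrow> ('do, 'da) precategory \<Rightarrow>
   ('bo, 'ba, 'co, 'ca) prefunctor \<Rightarrow> ('bo, 'ba, 'do, 'da) prefunctor \<Rightarrow> 'co \<Rightarrow> 'do \<Rightarrow>
   (('bo \<times> 'da \<times> 'ca) \<times> ('bo \<times> 'da \<times> 'ca)) set" where
  "P_rel B C D F G c d =
     inv_image (span_rel (elements (comma_cat B C F c) (P_functor D G d))) as_element"

end

theory Submission
  imports Defs
begin

text \<open>
  A weak pullback square in \<open>D\<close> is exactly what lets elements \<open>v\<^sub>1 : d \<rightarrow> G b\<^sub>1\<close> and \<open>v\<^sub>2 : d \<rightarrow> G b\<^sub>2\<close>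
  with the same image in \<open>G b\<close> be lifted to a common \<open>v : d \<rightarrow> G w\<close>. Hence under (WPC) every cospan
  of elements of \<open>P\<close> can be completed to a commutative square, so that two spans with a common foot
  compose and the span relation is transitive. Every cocone is constant along spans; once the span
  relation is an equivalence, its quotient is therefore the colimit.
\<close>

section \<open>The span relation as an equivalence\<close>

text \<open>Two spans with common foot \<open>y\<close> contain a cospan from their apexes into
  \<open>y\<close>; a span completing it, composed with the outer legs, gives transitivity. Since
  \<open>span_rel\<close> records only that arrows exist, \<open>cospan\<close> is stated through
  nonempty hom-sets.\<close>

lemma equiv_span_relI:
  assumes "category K"
    and cospan: "\<And>x y z f g. f \<in> Hom K x z \<Longrightarrow> g \<in> Hom K y z \<Longrightarrow>
      \<exists>w. Hom K w x \<noteq> {} \<and> Hom K w y \<noteq> {}"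
  shows "equiv (Obj K) (span_rel K)"
proof (rule equivI)
  interpret category K by fact
  show "span_rel K \<subseteq> Obj K \<times> Obj K" by (auto simp: span_rel_def)
  show "refl_on (Obj K) (span_rel K)"
    using Ident_Hom by (fastforce simp: refl_on_def span_rel_def)
  show "sym (span_rel K)" by (auto simp: sym_def span_rel_def)
  show "trans (span_rel K)"
  proof (rule transI)
    fix x y z assume "(x, y) \<in> span_rel K" "(y, z) \<in> span_rel K"
    then obtain w p q w' p' q' where xz: "x \<in> Obj K" "z \<in> Obj K"
      and pq: "p \<in> Hom K w x" "q \<in> Hom K w y" "p' \<in> Hom K w' y" "q' \<in> Hom K w' z"
      by (auto simp: span_rel_def)
    obtain v r s where rs: "r \<in> Hom K v w" "s \<in> Hom K v w'"
      using cospan[OF pq(2,3)] by blast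
    have "v \<in> Obj K" using rs(1) Dom_Obj by (auto simp: Hom_def)
    then show "(x, z) \<in> span_rel K"
      using xz Comp_Hom[OF rs(1) pq(1)] Comp_Hom[OF rs(2) pq(4)] by (auto simp: span_rel_def)
  qed
qed

section \<open>Cocones and colimits in terms of spans of elements\<close>

lemma Obj_elements: "(k, x) \<in> Obj (elements K H) \<longleftrightarrow> k \<in> Obj K \<and> x \<in> fobj H k"
  by (simp add: elements_def)

lemma Hom_elements_nonempty_iff:
  "Hom (elements K H) (k, x) (k', x') \<noteq> {} \<longleftrightarrow>
     k \<in> Obj K \<and> x \<in> fobj H k \<and> k' \<in> Obj K \<and> x' \<in> fobj H k' \<and>
     (\<exists>f \<in> Hom K k k'. map_of_arrow (farr H f) x = x')"
  by (auto simp: elements_def Hom_def Let_def split: prod.splits)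

text \<open>Along each leg of the span, the cocone takes the same value as at the apex.\<close>

lemma is_cocone_span_rel:
  assumes "is_cocone K H L l" and "((k, x), (k', x')) \<in> span_rel (elements K H)"
  shows "l k x = l k' x'"
proof -
  obtain j w where "Hom (elements K H) (j, w) (k, x) \<noteq> {}" "Hom (elements K H) (j, w) (k', x') \<noteq> {}"
    using assms(2) by (auto simp: span_rel_def)
  then have "l k x = l j w" "l k' x' = l j w"
    using assms(1) by (auto simp: Hom_elements_nonempty_iff is_cocone_def)
  then show ?thesis by simp
qed

text \<open>Converse of \<open>is_cocone_span_rel\<close>: an arrow of elements, paired with the
  identity of its source, is already a span, so compatibility with arrows is an instance of
  constancy along spans.\<close>

lemma is_coconeI_span_rel:
  assumes "functor_between K set_cat H"
    and "\<And>k x. k \<in> Obj K \<Longrightarrow> x \<in> fobj H k \<Longrightarrow> l k x \<in> L"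
    and "\<And>k x k' x'. ((k, x), (k', x')) \<in> span_rel (elements K H) \<Longrightarrow> l k x = l k' x'"
  shows "is_cocone K H L l"
  unfolding is_cocone_def
proof (intro conjI ballI)
  interpret functor_between K set_cat H by fact
  interpret el: category "elements K H" by (rule category_elements) fact
  fix k k' f x assume k: "k \<in> Obj K" "k' \<in> Obj K" and f: "f \<in> Hom K k k'" and x: "x \<in> fobj H k"
  let ?x' = "map_of_arrow (farr H f) x"
  have "?x' \<in> fobj H k'"
    using farr_Hom[OF f] x by (auto simp: set_cat_def Hom_def map_of_arrow_def split: prod.splits)
  then have "Hom (elements K H) (k, x) (k', ?x') \<noteq> {}" and ob: "(k', ?x') \<in> Obj (elements K H)"
    using k f x by (auto simp: Hom_elements_nonempty_iff Obj_elements)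
  moreover have "(k, x) \<in> Obj (elements K H)"
    using k x by (simp add: Obj_elements)
  ultimately have "((k, x), (k', ?x')) \<in> span_rel (elements K H)"
    using el.Ident_Hom[of "(k, x)"] unfolding span_rel_def by blast
  then show "l k' ?x' = l k x" using assms(3) by metis
qed (use assms(2) in blast)

text \<open>Together the premises present \<open>L\<close> as the quotient of the elements by the
  span relation. Any other cocone is constant along spans, so it descends to \<open>L\<close> by
  \<open>ker\<close>, and uniquely so by \<open>surj\<close>.\<close>

lemma is_colimitI_span_rel:
  assumes cocone: "is_cocone K H L l"
    and surj: "\<And>y. y \<in> L \<Longrightarrow> \<exists>k \<in> Obj K. \<exists>x \<in> fobj H k. y = l k x"
    and ker: "\<And>k x k' x'. k \<in> Obj K \<Longrightarrow> x \<in> fobj H k \<Longrightarrow> k' \<in> Obj K \<Longrightarrow> x' \<in> fobj H k' \<Longrightarrow>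
      l k x = l k' x' \<Longrightarrow> ((k, x), (k', x')) \<in> span_rel (elements K H)"
  shows "is_colimit TYPE('y) K H L l"
  unfolding is_colimit_def
proof (intro conjI allI impI)
  fix M :: "'y set" and m assume m: "is_cocone K H M m"
  \<comment> \<open>The value at \<open>y\<close> is the common value of \<open>m\<close> on all
    elements that \<open>l\<close> sends to \<open>y\<close>.\<close>
  define h where
    "h = (\<lambda>y \<in> L. THE z. \<exists>k \<in> Obj K. \<exists>x \<in> fobj H k. y = l k x \<and> z = m k x)"
  have l: "l k x \<in> L" if "k \<in> Obj K" "x \<in> fobj H k" for k x
    using cocone that by (simp add: is_cocone_def)
  have h: "h (l k x) = m k x" if kx: "k \<in> Obj K" "x \<in> fobj H k" for k x
    unfolding h_def restrict_apply' [OF l[OF kx]]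
  proof (rule the_equality)
    fix z assume "\<exists>k' \<in> Obj K. \<exists>x' \<in> fobj H k'. l k x = l k' x' \<and> z = m k' x'"
    then show "z = m k x" using is_cocone_span_rel[OF m ker[OF kx]] by metis
  qed (use kx in blast)
  show "\<exists>!h. h \<in> L \<rightarrow>\<^sub>E M \<and> (\<forall>k \<in> Obj K. \<forall>x \<in> fobj H k. h (l k x) = m k x)"
  proof (rule ex1I[of _ h])
    have "h y \<in> M" if y: "y \<in> L" for y
    proof -
      obtain k x where "k \<in> Obj K" "x \<in> fobj H k" "y = l k x" using surj[OF y] by blast
      then show ?thesis using h m by (simp add: is_cocone_def)
    qed
    moreover have "h \<in> extensional L" by (simp add: h_def)
    ultimately show "h \<in> L \<rightarrow>\<^sub>E M \<and> (\<forall>k \<in> Obj K. \<forall>x \<in> fobj H k. h (l k x) = m k x)"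
      using h by (auto simp: PiE_def)
  next
    fix h' assume h': "h' \<in> L \<rightarrow>\<^sub>E M \<and> (\<forall>k \<in> Obj K. \<forall>x \<in> fobj H k. h' (l k x) = m k x)"
    show "h' = h"
    proof
      fix y show "h' y = h y"
      proof (cases "y \<in> L")
        case True
        then obtain k x where "k \<in> Obj K" "x \<in> fobj H k" "y = l k x" using surj by blast
        then show ?thesis using h h' by simp
      next
        case False
        \<comment> \<open>Both maps are extensional, hence \<open>undefined\<close> outside
          \<open>L\<close>.\<close>
        then show ?thesis using h' by (auto simp: h_def)
      qed
    qed
  qed
qed (rule cocone)

text \<open>
  If some \<open>y\<close> were missed by the injections, changing a mediating map at \<open>y\<close> alone would contradict
  uniqueness. Testing against a type with two elements is enough, which avoids comparing \<open>L\<close> with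
  itself over its own type.
\<close>
lemma is_colimit_surj:
  assumes colim: "is_colimit TYPE('y) K H L l"
    and "y \<in> L" and two: "(a :: 'y) \<noteq> b"
  shows "\<exists>k \<in> Obj K. \<exists>x \<in> fobj H k. y = l k x"
proof (rule ccontr)
  assume miss: "\<not> ?thesis"
  let ?med = "\<lambda>h. h \<in> L \<rightarrow>\<^sub>E (UNIV :: 'y set) \<and> (\<forall>k \<in> Obj K. \<forall>x \<in> fobj H k. h (l k x) = a)"
  have "is_cocone K H (UNIV :: 'y set) (\<lambda>_ _. a)" by (simp add: is_cocone_def)
  then have uniq: "\<exists>!h. ?med h" using colim unfolding is_colimit_def by blast
  have l: "l k x \<in> L" if "k \<in> Obj K" "x \<in> fobj H k" for k x
    using colim that by (simp add: is_colimit_def is_cocone_def)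
  have "?med (\<lambda>z \<in> L. a)" using l by auto
  moreover have "?med (\<lambda>z \<in> L. if z = y then b else a)" using l miss by auto
  ultimately have "(\<lambda>z \<in> L. a) = (\<lambda>z \<in> L. if z = y then b else a)" using uniq by blast
  from fun_cong[OF this, of y] show False using \<open>y \<in> L\<close> two by simp
qed

text \<open>The mediating map \<open>h\<close> is onto by \<open>surj\<close>. It is injective
  because all elements of \<open>L\<close> come from injections: equal values of \<open>h\<close>
  are equal values of \<open>m\<close>, hence give a span, which \<open>l\<close> cannot separate.
  Universality of \<open>L\<close> is thus tested only at the type of \<open>M\<close>.\<close>

lemma is_colimit_bij_betw:
  fixes M :: "'y set"
  assumes colim: "is_colimit TYPE('y) K H L l" and two: "(a :: 'y) \<noteq> b"
    and cocone: "is_cocone K H M m"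
    and surj: "\<And>y. y \<in> M \<Longrightarrow> \<exists>k \<in> Obj K. \<exists>x \<in> fobj H k. y = m k x"
    and ker: "\<And>k x k' x'. k \<in> Obj K \<Longrightarrow> x \<in> fobj H k \<Longrightarrow> k' \<in> Obj K \<Longrightarrow> x' \<in> fobj H k' \<Longrightarrow>
      m k x = m k' x' \<Longrightarrow> ((k, x), (k', x')) \<in> span_rel (elements K H)"
  shows "\<exists>h. bij_betw h L M \<and> (\<forall>k \<in> Obj K. \<forall>x \<in> fobj H k. h (l k x) = m k x)"
proof -
  have coc: "is_cocone K H L l" using colim by (simp add: is_colimit_def)
  obtain h where hM: "h \<in> L \<rightarrow>\<^sub>E M"
    and h: "\<And>k x. k \<in> Obj K \<Longrightarrow> x \<in> fobj H k \<Longrightarrow> h (l k x) = m k x"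
    using colim cocone unfolding is_colimit_def by blast
  have "inj_on h L"
  proof (rule inj_onI)
    fix y y' assume yy: "y \<in> L" "y' \<in> L" and eq: "h y = h y'"
    obtain k x where kx: "k \<in> Obj K" "x \<in> fobj H k" "y = l k x"
      using is_colimit_surj[OF colim yy(1) two] by blast
    obtain k' x' where kx': "k' \<in> Obj K" "x' \<in> fobj H k'" "y' = l k' x'"
      using is_colimit_surj[OF colim yy(2) two] by blast
    have "((k, x), (k', x')) \<in> span_rel (elements K H)"
      using ker kx kx' eq h by simp
    then show "y = y'" using is_cocone_span_rel[OF coc] kx kx' by simp
  qed
  moreover have "h ` L = M"
  proof
    show "h ` L \<subseteq> M" using hM by auto
    show "M \<subseteq> h ` L"
    proof
      fix y assume "y \<in> M"
      then obtain k x where kx: "k \<in> Obj K" "x \<in> fobj H k" "y = m k x" using surj by blast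
      then have "l k x \<in> L" using coc by (simp add: is_cocone_def)
      then show "y \<in> h ` L" using h kx by force
    qed
  qed
  ultimately show ?thesis using h by (auto simp: bij_betw_def)
qed

section \<open>The elements of \<open>P_functor\<close> and their cospans\<close>

lemma Obj_comma_cat: "(b, u) \<in> Obj (comma_cat B C F c) \<longleftrightarrow> b \<in> Obj B \<and> u \<in> Hom C (fobj F b) c"
  by (simp add: comma_cat_def)

lemma fobj_P_functor: "fobj (P_functor D G d) (b, u) = Hom D d (fobj G b)"
  by (simp add: P_functor_def functor_comp_def comma_forget_def hom_functor_def)

text \<open>Strips both layers of triples, so that arrows of elements become arrows of
  \<open>B\<close>, where (WPC) applies.\<close>

lemma Hom_elements_P_nonempty_iff:
  assumes "functor_between B D G"
  shows "Hom (elements (comma_cat B C F c) (P_functor D G d)) ((b, u), v) ((b', u'), v') \<noteq> {} \<longleftrightarrow>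
    b \<in> Obj B \<and> u \<in> Hom C (fobj F b) c \<and> v \<in> Hom D d (fobj G b) \<and>
    b' \<in> Obj B \<and> u' \<in> Hom C (fobj F b') c \<and> v' \<in> Hom D d (fobj G b') \<and>
    (\<exists>f \<in> Hom B b b'. u' \<cdot>\<^bsub>C\<^esub> farr F f = u \<and> farr G f \<cdot>\<^bsub>D\<^esub> v = v')"
proof -
  interpret functor_between B D G by fact
  have bex: "(\<exists>\<phi> \<in> Hom (comma_cat B C F c) (b, u) (b', u'). Q \<phi>) \<longleftrightarrow>
      b \<in> Obj B \<and> u \<in> Hom C (fobj F b) c \<and> b' \<in> Obj B \<and> u' \<in> Hom C (fobj F b') c \<and>
      (\<exists>f \<in> Hom B b b'. u' \<cdot>\<^bsub>C\<^esub> farr F f = u \<and> Q ((b, u), f, (b', u')))" for Q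
    by (auto simp: comma_cat_def Hom_def)
  \<comment> \<open>The hom-functor acts by a restricted function, so it computes to composition
    only for \<open>v\<close> in the hom-set.\<close>
  have map: "map_of_arrow (farr (P_functor D G d) ((b, u), f, (b', u'))) v = farr G f \<cdot>\<^bsub>D\<^esub> v"
    if "f \<in> Hom B b b'" "v \<in> Hom D d (fobj G b)" for f
    using farr_Hom[OF that(1)] that(2)
    by (auto simp: P_functor_def functor_comp_def comma_forget_def hom_functor_def
        map_of_arrow_def Hom_def)
  show ?thesis
    unfolding Hom_elements_nonempty_iff Obj_comma_cat fobj_P_functor bex
    using map by (auto cong: bex_cong)
qed

lemma WPC_elements_cospan:
  fixes c
  assumes "functor_between B C F" "functor_between B D G" "d \<in> Obj D" "WPC B D G"
  defines "E \<equiv> elements (comma_cat B C F c) (P_functor D G d)"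
  assumes "Hom E x z \<noteq> {}" "Hom E y z \<noteq> {}"
  shows "\<exists>w. Hom E w x \<noteq> {} \<and> Hom E w y \<noteq> {}"
proof -
  interpret F: functor_between B C F by fact
  interpret G: functor_between B D G by fact
  note Hom_E = Hom_elements_P_nonempty_iff[OF assms(2), of C F c d, folded E_def]
  obtain b\<^sub>1 u\<^sub>1 v\<^sub>1 where x: "x = ((b\<^sub>1, u\<^sub>1), v\<^sub>1)" by (metis surj_pair)
  obtain b\<^sub>2 u\<^sub>2 v\<^sub>2 where y: "y = ((b\<^sub>2, u\<^sub>2), v\<^sub>2)" by (metis surj_pair)
  obtain b u v where z: "z = ((b, u), v)" by (metis surj_pair)
  obtain f where b\<^sub>1: "b\<^sub>1 \<in> Obj B" "u\<^sub>1 \<in> Hom C (fobj F b\<^sub>1) c" "v\<^sub>1 \<in> Hom D d (fobj G b\<^sub>1)"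
    and b: "b \<in> Obj B" "u \<in> Hom C (fobj F b) c"
    and f: "f \<in> Hom B b\<^sub>1 b" "u \<cdot>\<^bsub>C\<^esub> farr F f = u\<^sub>1" "farr G f \<cdot>\<^bsub>D\<^esub> v\<^sub>1 = v"
    using assms(6) unfolding x z Hom_E by blast
  obtain g where b\<^sub>2: "b\<^sub>2 \<in> Obj B" "u\<^sub>2 \<in> Hom C (fobj F b\<^sub>2) c" "v\<^sub>2 \<in> Hom D d (fobj G b\<^sub>2)"
    and g: "g \<in> Hom B b\<^sub>2 b" "u \<cdot>\<^bsub>C\<^esub> farr F g = u\<^sub>2" "farr G g \<cdot>\<^bsub>D\<^esub> v\<^sub>2 = v"
    using assms(7) unfolding y z Hom_E by blast
  obtain w p q where w: "w \<in> Obj B" and p: "p \<in> Hom B w b\<^sub>1" and q: "q \<in> Hom B w b\<^sub>2"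
    and sq: "f \<cdot>\<^bsub>B\<^esub> p = g \<cdot>\<^bsub>B\<^esub> q"
    and wpb: "weak_pullback D (fobj G w) (fobj G b\<^sub>1) (fobj G b\<^sub>2) (fobj G b)
      (farr G p) (farr G q) (farr G f) (farr G g)"
    using \<open>WPC B D G\<close> b\<^sub>1(1) b\<^sub>2(1) b(1) f(1) g(1) unfolding WPC_def by blast
  \<comment> \<open>\<open>v\<^sub>1\<close> and \<open>v\<^sub>2\<close> both map to
    \<open>v\<close>, so they form a cone with vertex \<open>d\<close> that factors through the weak
    pullback.\<close>
  obtain h where h: "h \<in> Hom D d (fobj G w)" "farr G p \<cdot>\<^bsub>D\<^esub> h = v\<^sub>1" "farr G q \<cdot>\<^bsub>D\<^esub> h = v\<^sub>2"
    using wpb \<open>d \<in> Obj D\<close> b\<^sub>1(3) b\<^sub>2(3) f(3) g(3) unfolding weak_pullback_def by metis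
  \<comment> \<open>The apex needs one \<open>C\<close>-component for both legs:
    \<open>u\<^sub>1\<close> and \<open>u\<^sub>2\<close> factor through \<open>u\<close>, and the
    square in \<open>B\<close> commutes.\<close>
  have "u\<^sub>1 \<cdot>\<^bsub>C\<^esub> farr F p = u \<cdot>\<^bsub>C\<^esub> farr F (f \<cdot>\<^bsub>B\<^esub> p)"
    using F.cod.Comp_assoc[OF F.farr_Hom[OF p] F.farr_Hom[OF f(1)] b(2)] F.farr_Comp[OF p f(1)] f(2)
    by simp
  also have "\<dots> = u\<^sub>2 \<cdot>\<^bsub>C\<^esub> farr F q"
    using F.cod.Comp_assoc[OF F.farr_Hom[OF q] F.farr_Hom[OF g(1)] b(2)] F.farr_Comp[OF q g(1)] g(2)
    by (simp add: sq)
  finally have u: "u\<^sub>2 \<cdot>\<^bsub>C\<^esub> farr F q = u\<^sub>1 \<cdot>\<^bsub>C\<^esub> farr F p" ..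
  have "u\<^sub>1 \<cdot>\<^bsub>C\<^esub> farr F p \<in> Hom C (fobj F w) c"
    by (rule F.cod.Comp_Hom[OF F.farr_Hom[OF p] b\<^sub>1(2)])
  then have "Hom E ((w, u\<^sub>1 \<cdot>\<^bsub>C\<^esub> farr F p), h) x \<noteq> {}" "Hom E ((w, u\<^sub>1 \<cdot>\<^bsub>C\<^esub> farr F p), h) y \<noteq> {}"
    unfolding x y Hom_E using w p q b\<^sub>1 b\<^sub>2 h u by blast+
  then show ?thesis by blast
qed

section \<open>The colimit as a quotient of the coproduct\<close>

theorem lemma2p10:
  fixes B :: "('bo, 'ba) precategory"
    and C :: "('co, 'ca) precategory"
    and D :: "('do, 'da) precategory"
    and F :: "('bo, 'ba, 'co, 'ca) prefunctor"
    and G :: "('bo, 'ba, 'do, 'da) prefunctor"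
    and c :: 'co and d :: 'do
  assumes "category B" and "category C" and "category D"
    and "functor_between B C F" and "functor_between B D G"
    and "c \<in> Obj C" and "d \<in> Obj D"
    and "WPC B D G"
  defines "K \<equiv> comma_cat B C F c"
    and "P \<equiv> P_functor D G d"
    and "X \<equiv> P_coproduct B C D F G c d"
    and "R \<equiv> P_rel B C D F G c d"
  shows "equiv (Obj (elements K P)) (span_rel (elements K P)) \<and>
    is_colimit TYPE('y) K P (X // R) (\<lambda>(b, u) v. R `` {(b, v, u)}) \<and>
    (\<forall>(L :: 'l set) l. is_colimit TYPE(('bo \<times> 'da \<times> 'ca) set) K P L l \<longrightarrow>
       (\<exists>h. bij_betw h L (X // R) \<and>
          (\<forall>(b, u) \<in> Obj K. \<forall>v \<in> fobj P (b, u). h (l (b, u) v) = R `` {(b, v, u)})))"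
proof -
  let ?m = "\<lambda>(b, u) v. R `` {(b, v, u)}"
  have funP: "functor_between K set_cat P"
    unfolding K_def P_def using assms(4,5,7) by (rule functor_P_functor)
  have eq: "equiv (Obj (elements K P)) (span_rel (elements K P))"
  proof (rule equiv_span_relI)
    show "category (elements K P)" using funP by (rule category_elements)
    show "\<exists>w. Hom (elements K P) w x \<noteq> {} \<and> Hom (elements K P) w y \<noteq> {}"
      if "f \<in> Hom (elements K P) x z" "g \<in> Hom (elements K P) y z" for x y z f g
      using WPC_elements_cospan[OF assms(4,5,7,8), of c x z y] that unfolding K_def P_def by blast
  qed
  have R: "((b, v, u), (b', v', u')) \<in> R \<longleftrightarrow>
      (((b, u), v), ((b', u'), v')) \<in> span_rel (elements K P)" for b v u b' v' u'
    by (simp add: R_def P_rel_def K_def P_def as_element_def)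
  have X: "(b, v, u) \<in> X \<longleftrightarrow> (b, u) \<in> Obj K \<and> v \<in> fobj P (b, u)" for b v u
    by (auto simp: X_def P_coproduct_def K_def P_def Obj_comma_cat fobj_P_functor)
  \<comment> \<open>Transported to the coproduct, the equivalence lets spans and equal classes be
    exchanged: \<open>ker\<close> turns equal classes into a span, \<open>cocone\<close> a span into
    equal classes.\<close>
  have eqR: "equiv X R"
  proof (rule equivI)
    show "R \<subseteq> X \<times> X"
      using equiv_type[OF eq] by (auto simp: R X Obj_elements dest!: subsetD)
    show "refl_on X R"
      using eq by (auto simp: refl_on_def equiv_def R X Obj_elements)
    show "sym R" "trans R"
      using eq unfolding R_def P_rel_def K_def P_def equiv_def
      by (simp_all add: sym_inv_image trans_inv_image)
  qed
  have ker: "((k, x), (k', x')) \<in> span_rel (elements K P)"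
    if "k \<in> Obj K" "x \<in> fobj P k" "k' \<in> Obj K" "x' \<in> fobj P k'" "?m k x = ?m k' x'" for k x k' x'
    using that eq_equiv_class[OF _ eqR] by (cases k; cases k') (simp add: R[symmetric] X)
  have surj: "\<exists>k \<in> Obj K. \<exists>x \<in> fobj P k. y = ?m k x" if "y \<in> X // R" for y
    using that by (force elim!: quotientE simp: X)
  have cocone: "is_cocone K P (X // R) ?m"
  proof (rule is_coconeI_span_rel[OF funP])
    show "?m k x \<in> X // R" if "k \<in> Obj K" "x \<in> fobj P k" for k x
      using that by (cases k) (auto simp: X intro!: quotientI)
    show "?m k x = ?m k' x'" if "((k, x), (k', x')) \<in> span_rel (elements K P)" for k x k' x'
      using that equiv_class_eq[OF eqR] by (cases k; cases k') (simp add: R)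
  qed
  have "\<exists>h. bij_betw h L (X // R) \<and>
      (\<forall>(b, u) \<in> Obj K. \<forall>v \<in> fobj P (b, u). h (l (b, u) v) = R `` {(b, v, u)})"
    if "is_colimit TYPE(('bo \<times> 'da \<times> 'ca) set) K P L l" for L :: "'l set" and l
    \<comment> \<open>The two distinct values required of the test type are \<open>{}\<close> and
      \<open>UNIV\<close>, as its elements are sets.\<close>
    using is_colimit_bij_betw[OF that empty_not_UNIV cocone surj ker] by fastforce
  then show ?thesis
    using eq is_colimitI_span_rel[OF cocone surj ker] by blast
qed

end
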